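(* Let $X$ be a normed space over $\mathbb{F}\in\{\mathbb{R},\mathbb{C}\}$ of dimension at least 2, and let $T,S\in\mathbb{B}(X)$. Then the following conditions are equivalent: (i) $T\parallel_v S$. (ii) There exist sequences $\{x_n\}_{n\ge1}\subset S_X$ and $\{x_n^*\}_{n\ge1}\subset S_{X^*}$ with $x_n^*(x_n)=1$ for all $n\ge1$ such that $\lim_{n\to\infty}|x_n^*(Tx_n)|\,|x_n^*(Sx_n)|=v(T)v(S)$. (iii) There exist sequences $\{x_n\}_{n\ge1}\subset S_X$ and $\{x_n^*\}_{n\ge1}\subset S_{X^*}$ with $x_n^*(x_n)=1$ for all $n\ge1$ such that $\lim_{n\to\infty}|x_n^*(Tx_n)|=v(T)$ and $\lim_{n\to\infty}|x_n^*(Sx_n)|=v(S)$.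
   Context: $\mathbb{B}(X)$ is the space of bounded linear operators $X\to X$; $S_X$ is the unit sphere of $X$ and $S_{X^*}$ that of its dual $X^*$; $\mathbb{T}=\{\lambda\in\mathbb{F}:|\lambda|=1\}$. For $x\in X$, $J(x)=\{x^*\in S_{X^*}: x^*(x)=\|x\|\}$. The numerical radius of $T\in\mathbb{B}(X)$ is $v(T)=\sup\{|x^*(Tx)|: x\in S_X,\ x^*\in J(x)\}$. $T$ is numerical radius parallel to $S$, written $T\parallel_v S$, if $v(T+\lambda S)=v(T)+v(S)$ for some $\lambda\in\mathbb{T}$. *)

theory Defs
  imports "HOL-Analysis.Analysis"
begin

text \<open>Scalar fields: isometrically isomorphic, as a real algebra, to the reals or the
  complex numbers. A type of this class plays the role of the scalar field.\<close>

class real_or_complex = real_normed_field +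
  assumes real_or_complex:
    "(\<exists>h :: 'a \<Rightarrow> real.
        bij h \<and>
        (\<forall>a b. h (a + b) = h a + h b) \<and> (\<forall>r a. h (r *\<^sub>R a) = r *\<^sub>R h a) \<and>
        (\<forall>a b. h (a * b) = h a * h b) \<and> (\<forall>a. norm (h a) = norm a)) \<or>
     (\<exists>h :: 'a \<Rightarrow> complex.
        bij h \<and>
        (\<forall>a b. h (a + b) = h a + h b) \<and> (\<forall>r a. h (r *\<^sub>R a) = r *\<^sub>R h a) \<and>
        (\<forall>a b. h (a * b) = h a * h b) \<and> (\<forall>a. norm (h a) = norm a))"

instance real :: real_or_complex
  by (intro_classes, intro disjI1 exI[of _ id]) simp_all

instance complex :: real_or_complex
  by (intro_classes, intro disjI2 exI[of _ id]) simp_all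

text \<open>The library's normed spaces are real. Here \<open>smul\<close> is the multiplication by scalars of
  the field \<open>'k\<close>, required to extend the real scalar multiplication of the type \<open>'a\<close>;
  for \<open>'k = real\<close> it is therefore just \<open>scaleR\<close>.\<close>

locale normed_space_over = vector_space smul
  for smul :: "'k::real_or_complex \<Rightarrow> 'a::real_normed_vector \<Rightarrow> 'a" +
  assumes scale_of_real: "smul (of_real r) x = r *\<^sub>R x"
    and norm_scale: "norm (smul c x) = norm c * norm x"

lemma normed_space_over_scaleR:
  "normed_space_over (scaleR :: real \<Rightarrow> 'a::real_normed_vector \<Rightarrow> 'a)"
  by unfold_locales (simp_all add: algebra_simps)

lemma normed_space_over_mult:
  "normed_space_over ((*) :: 'k::real_or_complex \<Rightarrow> 'k \<Rightarrow> 'k)"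
  by unfold_locales (simp_all add: algebra_simps scaleR_conv_of_real norm_mult)

text \<open>Some basis is infinite or has at least \<open>n\<close> elements. The library function \<open>dim\<close> is not
  used because it yields \<open>0\<close> on infinite-dimensional spaces.\<close>

definition dim_at_least ::
    "('k::real_or_complex \<Rightarrow> 'a::real_normed_vector \<Rightarrow> 'a) \<Rightarrow> nat \<Rightarrow> bool" where
  "dim_at_least smul n \<longleftrightarrow>
     (\<exists>B. \<not> module.dependent smul B \<and> module.span smul B = UNIV \<and> (infinite B \<or> n \<le> card B))"

definition bounded_linear_over ::
    "('k::real_or_complex \<Rightarrow> 'a::real_normed_vector \<Rightarrow> 'a) \<Rightarrow>
     ('k \<Rightarrow> 'b::real_normed_vector \<Rightarrow> 'b) \<Rightarrow> ('a \<Rightarrow> 'b) \<Rightarrow> bool" where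
  "bounded_linear_over smul1 smul2 f \<longleftrightarrow>
     Vector_Spaces.linear smul1 smul2 f \<and> (\<exists>K. \<forall>x. norm (f x) \<le> K * norm x)"

definition bounded_operators ::
    "('k::real_or_complex \<Rightarrow> 'a::real_normed_vector \<Rightarrow> 'a) \<Rightarrow> ('a \<Rightarrow> 'a) set" where
  "bounded_operators smul = {T. bounded_linear_over smul smul T}"

definition dual_space ::
    "('k::real_or_complex \<Rightarrow> 'a::real_normed_vector \<Rightarrow> 'a) \<Rightarrow> ('a \<Rightarrow> 'k) set" where
  "dual_space smul = {f. bounded_linear_over smul (*) f}"

definition dual_sphere ::
    "('k::real_or_complex \<Rightarrow> 'a::real_normed_vector \<Rightarrow> 'a) \<Rightarrow> ('a \<Rightarrow> 'k) set" where
  "dual_sphere smul = {f \<in> dual_space smul. onorm f = 1}"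

definition support_functionals ::
    "('k::real_or_complex \<Rightarrow> 'a::real_normed_vector \<Rightarrow> 'a) \<Rightarrow> 'a \<Rightarrow> ('a \<Rightarrow> 'k) set" where
  "support_functionals smul x = {f \<in> dual_sphere smul. f x = of_real (norm x)}"

definition numerical_radius ::
    "('k::real_or_complex \<Rightarrow> 'a::real_normed_vector \<Rightarrow> 'a) \<Rightarrow> ('a \<Rightarrow> 'a) \<Rightarrow> real" where
  "numerical_radius smul T =
     Sup {norm (f (T x)) | x f. x \<in> sphere 0 1 \<and> f \<in> support_functionals smul x}"

definition numerical_radius_parallel ::
    "('k::real_or_complex \<Rightarrow> 'a::real_normed_vector \<Rightarrow> 'a) \<Rightarrow> ('a \<Rightarrow> 'a) \<Rightarrow> ('a \<Rightarrow> 'a) \<Rightarrow> bool"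
where
  "numerical_radius_parallel smul T S \<longleftrightarrow>
     (\<exists>c. norm c = 1 \<and>
        numerical_radius smul (\<lambda>x. T x + smul c (S x)) =
          numerical_radius smul T + numerical_radius smul S)"

end

theory Submission
  imports Defs
begin

text \<open>Put \<open>a = f (T x)\<close> and \<open>b = f (S x)\<close>. If \<open>\<bar>a\<^sub>n + c b\<^sub>n\<bar>\<close> tends to \<open>v T + v S\<close>, the triangle
  inequality forces both moduli to their suprema. Conversely, align each \<open>b\<^sub>n\<close> with \<open>a\<^sub>n\<close> by
  a unimodular scalar and pass to a limit in the compact unit sphere of the field. When one
  numerical radius vanishes, the product limit carries no information, but then any
  maximizing sequence for the other operator serves. The suprema are taken over a
  nonempty set by the Hahn--Banach theorem.\<close>

section \<open>Sublinear functionals and the real Hahn--Banach theorem\<close>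

definition sublinear :: "('a::real_vector \<Rightarrow> real) \<Rightarrow> bool" where
  "sublinear p \<longleftrightarrow> (\<forall>x y. p (x + y) \<le> p x + p y) \<and> (\<forall>t x. 0 \<le> t \<longrightarrow> p (t *\<^sub>R x) = t * p x)"

lemma sublinear_add: "sublinear p \<Longrightarrow> p (x + y) \<le> p x + p y"
  and sublinear_scaleR: "sublinear p \<Longrightarrow> 0 \<le> t \<Longrightarrow> p (t *\<^sub>R x) = t * p x"
  by (simp_all add: sublinear_def)

lemma sublinear_0: "sublinear p \<Longrightarrow> p 0 = 0"
  using sublinear_scaleR[of p 0 0] by simp

lemma sublinear_ge_minus: "sublinear p \<Longrightarrow> - p (- x) \<le> p x"
  using sublinear_add[of p x "- x"] sublinear_0[of p] by simp

text \<open>Applied to \<open>inverse t\<close> and \<open>t *\<^sub>R x\<close>, the one-sided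
  hypothesis \<open>scale\<close> yields the reverse inequality, so homogeneity need only be checked
  as an upper bound.\<close>

lemma sublinearI:
  assumes add: "\<And>x y. p (x + y) \<le> p x + p y"
    and zero: "p 0 = 0"
    and scale: "\<And>t x. 0 < t \<Longrightarrow> p (t *\<^sub>R x) \<le> t * p x"
  shows "sublinear p"
  unfolding sublinear_def
proof (intro conjI allI impI)
  fix t :: real and x
  assume "0 \<le> t"
  show "p (t *\<^sub>R x) = t * p x"
  proof (cases "t = 0")
    case False
    with \<open>0 \<le> t\<close> have t: "0 < t" by simp
    have "p x \<le> inverse t * p (t *\<^sub>R x)"
      using scale[of "inverse t" "t *\<^sub>R x"] t by simp
    then have "t * p x \<le> p (t *\<^sub>R x)"
      using t by (simp add: field_simps)
    with scale[OF t] show ?thesis by (simp add: antisym)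
  qed (simp add: zero)
qed (rule add)

lemma sublinear_norm: "sublinear norm"
  by (simp add: sublinear_def norm_triangle_ineq)

text \<open>Reduction of \<open>p\<close> along one direction: \<open>q x\<close> is the infimum of
  the right-hand side over \<open>t\<close>. Later, \<open>t = 0\<close> gives
  \<open>q \<le> p\<close>, and \<open>t = 1\<close> gives the strict gain
  \<open>q x \<le> p (x + y) - p y\<close> over mere subadditivity.\<close>

lemma sublinear_below:
  assumes p: "sublinear p"
  obtains q where "sublinear q" "\<And>x t. 0 \<le> t \<Longrightarrow> q x \<le> p (x + t *\<^sub>R y) - t * p y"
proof -
  define g where "g x t = p (x + t *\<^sub>R y) - t * p y" for x t
  define q where "q x = (INF t\<in>{0..}. g x t)" for x
  \<comment> \<open>A bound independent of \<open>t\<close>, so that the infimum defining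
    \<open>q\<close> is a genuine one.\<close>
  have lower: "- p (- x) \<le> g x t" if "0 \<le> t" for x t
    using sublinear_add[OF p, of "x + t *\<^sub>R y" "- x"] sublinear_scaleR[OF p that, of y]
    by (simp add: g_def)
  have q_le: "q x \<le> g x t" if "0 \<le> t" for x t
    unfolding q_def by (rule cINF_lower) (use lower that in \<open>auto intro!: bdd_belowI2\<close>)
  have le_q: "c \<le> q x" if "\<And>t. 0 \<le> t \<Longrightarrow> c \<le> g x t" for c x
    unfolding q_def by (rule cINF_greatest) (use that in auto)
  have "sublinear q"
  proof (rule sublinearI)
    fix x z
    \<comment> \<open>The two infima are taken one at a time: \<open>s\<close> stays fixed while
      \<open>t\<close> varies, and the parameter \<open>t + s\<close> serves for
      \<open>x + z\<close>.\<close>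
    have "q (x + z) - g z s \<le> q x" if s: "0 \<le> s" for s
    proof (rule le_q)
      fix t :: real
      assume t: "0 \<le> t"
      have "q (x + z) \<le> g (x + z) (t + s)"
        using s t by (intro q_le) simp
      also have "\<dots> \<le> g x t + g z s"
        using sublinear_add[OF p, of "x + t *\<^sub>R y" "z + s *\<^sub>R y"]
        by (simp add: g_def algebra_simps)
      finally show "q (x + z) - g z s \<le> g x t" by simp
    qed
    then have "q (x + z) - q x \<le> q z"
      by (intro le_q) (simp add: algebra_simps)
    then show "q (x + z) \<le> q x + q z" by simp
  next
    have "g 0 t = 0" if "0 \<le> t" for t
      using that by (simp add: g_def sublinear_scaleR[OF p])
    with q_le[of 0 0] le_q[of 0 0] show "q 0 = 0" by simp
  next
    fix s :: real and x
    assume s: "0 < s"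
    have "q (s *\<^sub>R x) / s \<le> q x"
    proof (rule le_q)
      fix t :: real
      assume t: "0 \<le> t"
      have "q (s *\<^sub>R x) \<le> g (s *\<^sub>R x) (s * t)"
        using s t by (intro q_le) simp
      also have "\<dots> = s * g x t"
        using sublinear_scaleR[OF p, of s "x + t *\<^sub>R y"] s
        by (simp add: g_def algebra_simps)
      finally show "q (s *\<^sub>R x) / s \<le> g x t"
        using s by (simp add: field_simps)
    qed
    then show "q (s *\<^sub>R x) \<le> s * q x"
      using s by (simp add: field_simps)
  qed
  with q_le show ?thesis
    using that by (simp add: g_def)
qed

text \<open>The pointwise infimum works: the common majorant \<open>r\<close> bounds all members
  below by \<open>- r (- x)\<close>, and comparability puts one member below both \<open>p\<close>
  and \<open>q\<close> in the subadditivity estimate.\<close>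

lemma sublinear_Inf_chain:
  assumes sub: "\<And>p. p \<in> C \<Longrightarrow> sublinear p \<and> p \<le> r"
    and chain: "\<And>p q. p \<in> C \<Longrightarrow> q \<in> C \<Longrightarrow> p \<le> q \<or> q \<le> p"
    and ne: "C \<noteq> {}"
  obtains u where "sublinear u" "\<And>p. p \<in> C \<Longrightarrow> u \<le> p"
proof -
  define u where "u x = (INF p\<in>C. p x)" for x
  have lower: "- r (- x) \<le> p x" if "p \<in> C" for p x
    using sublinear_ge_minus[of p x] sub[OF that] by (auto simp: le_fun_def intro: order_trans[rotated])
  have u_le: "u x \<le> p x" if "p \<in> C" for p x
    unfolding u_def by (rule cINF_lower) (use lower that in \<open>auto intro!: bdd_belowI2\<close>)
  have le_u: "c \<le> u x" if "\<And>p. p \<in> C \<Longrightarrow> c \<le> p x" for c x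
    unfolding u_def by (rule cINF_greatest) (use that ne in auto)
  have "sublinear u"
  proof (rule sublinearI)
    fix x y
    have *: "u (x + y) \<le> p x + q y" if p: "p \<in> C" and q: "q \<in> C" for p q
    proof -
      obtain s where s: "s \<in> C" "s \<le> p" "s \<le> q"
        using chain[OF p q] p q by blast
      have "u (x + y) \<le> s (x + y)" by (rule u_le[OF s(1)])
      also have "\<dots> \<le> s x + s y" using sub[OF s(1)] by (simp add: sublinear_add)
      also have "\<dots> \<le> p x + q y" using s by (simp add: le_fun_def add_mono)
      finally show ?thesis .
    qed
    have "u (x + y) - q y \<le> u x" if "q \<in> C" for q
      using *[OF _ that] by (intro le_u) (simp add: algebra_simps)
    then have "u (x + y) - u x \<le> u y"
      by (intro le_u) (simp add: algebra_simps)
    then show "u (x + y) \<le> u x + u y" by simp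
  next
    have "p 0 = 0" if "p \<in> C" for p
      using sub[OF that] sublinear_0 by blast
    then show "u 0 = 0"
      using ne u_le[of _ 0] le_u[of 0 0] by (metis antisym ex_in_conv order_refl)
  next
    fix t :: real and x
    assume t: "0 < t"
    have "u (t *\<^sub>R x) / t \<le> u x"
    proof (rule le_u)
      fix p assume p: "p \<in> C"
      then show "u (t *\<^sub>R x) / t \<le> p x"
        using u_le[OF p, of "t *\<^sub>R x"] sub[OF p] t by (simp add: sublinear_scaleR field_simps)
    qed
    then show "u (t *\<^sub>R x) \<le> t * u x"
      using t by (simp add: field_simps)
  qed
  then show ?thesis
    using that u_le by (auto simp: le_fun_def)
qed

text \<open>Hahn--Banach: a minimal sublinear functional coincides with the smaller one
  obtained in \<open>sublinear_below\<close>, which makes it superadditive and hence linear.\<close>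

lemma linear_below_sublinear:
  assumes r: "sublinear r"
  obtains f where "linear f" "f \<le> r"
proof -
  let ?A = "{p. sublinear p \<and> p \<le> r}"
  \<comment> \<open>The order is reversed, so that the maximal element given by Zorn's lemma is a
    minimal sublinear functional.\<close>
  let ?P = "\<lambda>p q :: 'a \<Rightarrow> real. q \<le> p"
  have "\<exists>m\<in>?A. \<forall>p\<in>?A. ?P m p \<longrightarrow> p = m"
  proof (rule predicate_Zorn)
    show "partial_order_on ?A (relation_of ?P ?A)"
      by (rule partial_order_on_relation_ofI) auto
  next
    fix C
    assume C: "C \<in> Chains (relation_of ?P ?A)"
    show "\<exists>u\<in>?A. \<forall>p\<in>C. ?P p u"
    proof (cases "C = {}")
      case True
      with r show ?thesis by auto
    next
      case False
      have CA: "C \<subseteq> ?A" using C by (rule Chains_relation_of)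
      have chain: "p \<le> q \<or> q \<le> p" if "p \<in> C" "q \<in> C" for p q
        using C that by (auto simp: Chains_def relation_of_def)
      obtain u where "sublinear u" "\<And>p. p \<in> C \<Longrightarrow> u \<le> p"
        using sublinear_Inf_chain[of C r] CA chain False by blast
      moreover have "u \<le> r"
        using calculation(2) False CA by (blast intro: order_trans)
      ultimately show ?thesis by blast
    qed
  qed
  then obtain f where f: "sublinear f" "f \<le> r"
    and min: "\<And>p. sublinear p \<Longrightarrow> p \<le> f \<Longrightarrow> p = f"
    by (auto intro: order_trans)
  have add: "f (x + y) = f x + f y" for x y
  proof -
    obtain q where q: "sublinear q" "\<And>x t. 0 \<le> t \<Longrightarrow> q x \<le> f (x + t *\<^sub>R y) - t * f y"
      using sublinear_below[OF f(1), of y] by blast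
    have "q \<le> f"
      using q(2)[of 0] by (simp add: le_fun_def)
    then have "q = f" by (rule min[OF q(1)])
    then show ?thesis
      using q(2)[of 1 x] sublinear_add[OF f(1), of x y] by simp
  qed
  have neg: "f (- x) = - f x" for x
    using add[of x "- x"] sublinear_0[OF f(1)] by simp
  have "f (t *\<^sub>R x) = t * f x" for t x
  proof (cases "0 \<le> t")
    case False
    then show ?thesis
      using sublinear_scaleR[OF f(1), of "- t" x] neg[of "t *\<^sub>R x"] by simp
  qed (simp add: sublinear_scaleR[OF f(1)])
  with add have "linear f" by (intro linearI) auto
  with f that show ?thesis by blast
qed

text \<open>Hahn--Banach is applied not to the norm but to its reduction \<open>q\<close> along
  \<open>x\<close>. Since \<open>q (- x) \<le> - norm x\<close>, every linear
  \<open>u \<le> q\<close> satisfies \<open>norm x \<le> u x\<close>.\<close>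

lemma norming_functional_real:
  fixes x :: "'a::real_normed_vector"
  obtains u where "linear u" "\<And>y. u y \<le> norm y" "u x = norm x"
proof -
  obtain q where q: "sublinear q"
      "\<And>z t. 0 \<le> t \<Longrightarrow> q z \<le> norm (z + t *\<^sub>R x) - t * norm x"
    using sublinear_below[OF sublinear_norm, of x] by blast
  obtain u where u: "linear u" "u \<le> q"
    using linear_below_sublinear[OF q(1)] by blast
  have le: "u y \<le> norm y" for y
    using q(2)[of 0 y] u(2)[THEN le_funD, of y] by simp
  have "u (- x) \<le> - norm x"
    using q(2)[of 1 "- x"] u(2)[THEN le_funD, of "- x"] by simp
  then have "u x = norm x"
    using le[of x] linear_neg[OF u(1), of x] by simp
  with u(1) le that show ?thesis by blast
qed

section \<open>The scalar field: coordinates and compactness\<close>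

lemma real_or_complex_cases:
  obtains (real) "\<And>a :: 'k::real_or_complex. \<exists>r. a = of_real r"
  | (complex) e :: "'k::real_or_complex" where "e * e = - 1"
      "\<And>a. \<exists>r s. a = of_real r + of_real s * e"
      "\<And>r s. norm (of_real r + of_real s * e) = sqrt (r\<^sup>2 + s\<^sup>2)"
proof -
  \<comment> \<open>The isomorphism \<open>h\<close> serves to produce coordinates inside
    \<open>'k\<close> itself: either every scalar is an \<open>of_real\<close>, or \<open>e\<close>,
    the preimage of the imaginary unit, completes a basis.\<close>
  consider (R) h :: "'k \<Rightarrow> real" where "bij h" "\<And>r a. h (r *\<^sub>R a) = r *\<^sub>R h a"
      "\<And>a b. h (a * b) = h a * h b"
    | (C) h :: "'k \<Rightarrow> complex" where "bij h" "\<And>a b. h (a + b) = h a + h b"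
      "\<And>r a. h (r *\<^sub>R a) = r *\<^sub>R h a" "\<And>a b. h (a * b) = h a * h b"
      "\<And>a. norm (h a) = norm a"
    using real_or_complex[where 'a = 'k] by metis
  then show thesis
  proof cases
    case R
    \<comment> \<open>\<open>h 1\<close> is a nonzero idempotent real number, hence 1, which makes
      \<open>h\<close> and \<open>of_real\<close> mutually inverse.\<close>
    have "h a = h (of_real (h a))" for a
    proof -
      have "h 1 * h a = h a" "h 1 * h 1 = h 1" using R(3)[of 1] by simp_all
      moreover have "h 1 \<noteq> 0"
        using R(2)[of 0 0] R(1) by (metis bij_def inj_eq scaleR_zero_left zero_neq_one)
      ultimately show ?thesis
        by (simp add: of_real_def R(2))
    qed
    then have "a = of_real (h a)" for a
      using R(1) by (metis bij_def inj_eq)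
    then show thesis using real by blast
  next
    case C
    have h_eq: "h a = h b \<longleftrightarrow> a = b" for a b
      using C(1) by (metis bij_def inj_eq)
    have h0: "h 0 = 0" using C(2)[of 0 0] by simp
    have h1: "h 1 = 1"
      using C(4)[of 1 1] h_eq[of 1 0] h0 by simp
    have hr: "h (of_real r) = of_real r" for r
      by (simp add: of_real_def C(3) h1)
    obtain e where e: "h e = \<i>" using C(1) by (metis bij_pointE)
    have hrs: "h (of_real r + of_real s * e) = Complex r s" for r s
      by (simp add: C(2,4) hr e Complex_eq mult.commute)
    show thesis
    proof (rule complex)
      have "h (e * e + 1) = 0" by (simp add: C(2,4) e h1)
      then have "e * e + 1 = 0" using h_eq[of "e * e + 1" 0] h0 by simp
      then show "e * e = - 1" by (simp add: eq_neg_iff_add_eq_0)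
    next
      fix a
      have "h a = h (of_real (Re (h a)) + of_real (Im (h a)) * e)"
        by (simp add: hrs)
      then show "\<exists>r s. a = of_real r + of_real s * e" unfolding h_eq by blast
    next
      fix r s :: real
      show "norm (of_real r + of_real s * e) = sqrt (r\<^sup>2 + s\<^sup>2)"
        unfolding C(5)[symmetric] hrs complex_norm ..
    qed
  qed
qed

text \<open>The inverse of the isomorphism is an isometry, so the sphere is a continuous image of
  the compact unit sphere of the reals or the complex numbers.\<close>

lemma compact_unit_sphere: "compact (sphere 0 1 :: 'k::real_or_complex set)"
proof -
  have image: "compact (sphere 0 1 :: 'k set)"
    if h: "bij h" "\<And>a b. h (a + b) = h a + h b" "\<And>r a. h (r *\<^sub>R a) = r *\<^sub>R h a"
      "\<And>a. norm (h a) = norm a"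
    for h :: "'k \<Rightarrow> 'b::{real_normed_field,heine_borel}"
  proof -
    have lin: "linear h" using h by (intro linearI) auto
    have dist: "dist (inv h a) (inv h b) = dist a b" for a b
    proof -
      have "h (inv h a - inv h b) = a - b"
        by (simp add: linear_diff[OF lin] bij_is_surj[OF h(1)] surj_f_inv_f)
      then show ?thesis by (metis dist_norm h(4))
    qed
    have "continuous_on (sphere 0 1) (inv h)"
      unfolding continuous_on_iff dist by blast
    then have "compact (inv h ` sphere 0 1)"
      by (intro compact_continuous_image compact_sphere)
    moreover have "inv h ` sphere 0 1 = sphere 0 1"
    proof (intro equalityI subsetI)
      fix a assume "a \<in> inv h ` sphere 0 1"
      then show "a \<in> sphere 0 1"
        using h(4) by (auto simp: surj_f_inv_f[OF bij_is_surj[OF h(1)]] h(4)[symmetric])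
    next
      fix a :: 'k assume "a \<in> sphere 0 1"
      then show "a \<in> inv h ` sphere 0 1"
        using h(4) by (intro image_eqI[of _ _ "h a"]) (simp_all add: bij_is_inj[OF h(1)])
    qed
    ultimately show ?thesis by simp
  qed
  show ?thesis
    using real_or_complex[where 'a = 'k] by (elim disjE exE conjE) (rule image; blast)+
qed

section \<open>Supporting functionals over the scalar field\<close>

lemma (in normed_space_over) bounded_linear_functional:
  assumes "Vector_Spaces.linear smul (*) f"
    and K: "\<And>y. norm (f y) \<le> K * norm y"
  shows "bounded_linear f"
proof
  interpret f: Vector_Spaces.linear smul "(*)" f by (rule assms)
  show "f (a + b) = f a + f b" for a b by (rule f.add)
  show "f (r *\<^sub>R a) = r *\<^sub>R f a" for r a
    using f.scale[of "of_real r" a] by (simp add: scale_of_real scaleR_conv_of_real)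
  show "\<exists>K. \<forall>y. norm (f y) \<le> norm y * K"
    using K by (metis mult.commute)
qed

text \<open>\<open>u\<close> stands for the real part of \<open>f\<close>, but agreement at real
  values of \<open>f\<close> is enough: a unimodular \<open>c\<close> makes
  \<open>f (smul c y)\<close> equal to \<open>norm (f y)\<close>, and the bound on \<open>u\<close>
  applies there. The value 1 at \<open>x\<close> then fixes the operator norm.\<close>

lemma (in normed_space_over) support_functionalI:
  assumes lin: "Vector_Spaces.linear smul (*) f"
    and u_le: "\<And>y. u y \<le> norm y"
    and real_value: "\<And>y r. f y = of_real r \<Longrightarrow> u y = r"
    and x: "norm x = 1" "f x = 1"
  shows "f \<in> support_functionals smul x"
proof -
  interpret f: Vector_Spaces.linear smul "(*)" f by (rule lin)
  have bound: "norm (f y) \<le> norm y" for y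
  proof (cases "f y = 0")
    case False
    define c where "c = of_real (norm (f y)) / f y"
    have "f (smul c y) = of_real (norm (f y))"
      using False by (simp add: f.scale c_def)
    then have "norm (f y) = u (smul c y)" using real_value by simp
    also have "\<dots> \<le> norm (smul c y)" by (rule u_le)
    also have "\<dots> = norm y" using False by (simp add: norm_scale c_def norm_divide)
    finally show ?thesis .
  qed simp
  have "bounded_linear f"
    using bound by (intro bounded_linear_functional[OF lin, of 1]) simp
  then have "1 \<le> onorm f"
    using onorm[of f x] x by simp
  moreover have "onorm f \<le> 1"
    using bound by (intro onorm_bound) simp_all
  moreover have "bounded_linear_over smul (*) f"
    unfolding bounded_linear_over_def using lin bound by (intro conjI exI[of _ 1]) simp_all
  ultimately show ?thesis
    by (simp add: support_functionals_def dual_sphere_def dual_space_def x)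
qed

text \<open>A real norming functional \<open>u\<close> is made linear over the field: by
  \<open>of_real\<close> in the real case, otherwise by the Bohnenblust--Sobczyk formula f(y) = u(y)
  - i u(iy), with \<open>e\<close> for i.\<close>

lemma (in normed_space_over) support_functionals_nonempty:
  assumes x: "norm x = 1"
  shows "support_functionals smul x \<noteq> {}"
proof -
  obtain u :: "'a \<Rightarrow> real" where u: "linear u" "\<And>y. u y \<le> norm y" "u x = 1"
    using norming_functional_real[of x] x by metis
  have vs: "vector_space smul" "vector_space ((*) :: 'k \<Rightarrow> 'k \<Rightarrow> 'k)"
    using vector_space_axioms normed_space_over_mult normed_space_over.axioms(1) by blast+
  have u_add: "u (a + b) = u a + u b" for a b by (rule linear_add[OF u(1)])
  have u_scale: "u (smul (of_real r) a) = r * u a" for r a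
    using linear_scale[OF u(1), of r a] by (simp add: scale_of_real)
  show ?thesis
  proof (cases rule: real_or_complex_cases[where 'k = 'k])
    case real
    let ?f = "\<lambda>y. of_real (u y) :: 'k"
    have "?f \<in> support_functionals smul x"
    proof (rule support_functionalI[where u = u])
      have "?f (smul c y) = c * ?f y" for c y
        using real[of c] u_scale by auto
      then show "Vector_Spaces.linear smul (*) ?f"
        by (simp add: Vector_Spaces.linear_iff vs u_add)
    qed (use u x in auto)
    then show ?thesis by blast
  next
    case (complex e)
    let ?f = "\<lambda>y. of_real (u y) - of_real (u (smul e y)) * e"
    have "?f \<in> support_functionals smul x"
    proof (rule support_functionalI[where u = u])
      have "?f (smul c y) = c * ?f y" for c y
      proof -
        obtain r s where c: "c = of_real r + of_real s * e" using complex(2) by blast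
        have ec: "e * c = of_real r * e - of_real s"
        proof -
          have "e * c = of_real r * e + of_real s * (e * e)" by (simp add: c algebra_simps)
          then show ?thesis by (simp add: complex(1))
        qed
        have "u (smul c y) = r * u y + s * u (smul e y)"
          using u_scale[of s "smul e y"] by (simp add: c scale_left_distrib u_add u_scale)
        moreover have "u (smul e (smul c y)) = r * u (smul e y) - s * u y"
        proof -
          have "smul e (smul c y) = smul (of_real r) (smul e y) + smul (of_real (- s)) y"
            by (simp add: ec scale_left_diff_distrib)
          then show ?thesis by (simp only: u_add u_scale)
        qed
        ultimately have "?f (smul c y) = of_real (r * u y + s * u (smul e y))
            - of_real (r * u (smul e y) - s * u y) * e"
          by (simp only:)
        also have "\<dots> = (of_real r + of_real s * e) * ?f y"
        proof -
          have "(of_real r + of_real s * e) * (p - q * e)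
              = of_real r * p + of_real s * p * e - of_real r * q * e - of_real s * q * (e * e)" for p q
            by (simp add: algebra_simps)
          then show ?thesis unfolding complex(1) by simp (simp add: algebra_simps)
        qed
        finally show ?thesis by (simp only: c)
      qed
      then show "Vector_Spaces.linear smul (*) ?f"
        by (simp add: Vector_Spaces.linear_iff vs u_add scale_right_distrib algebra_simps)
      \<comment> \<open>Coordinates with respect to 1 and \<open>e\<close> are unique, because the
        norm of a scalar is the root of the sum of their squares.\<close>
      have rs: "u y = r" if "?f y = of_real r" for y r
      proof -
        have "of_real (u y - r) + of_real (- u (smul e y)) * e = 0"
          using that by (simp add: algebra_simps)
        then have "(u y - r)\<^sup>2 + (- u (smul e y))\<^sup>2 = 0"
          using complex(3)[of "u y - r" "- u (smul e y)"] by simp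
        then show ?thesis by (simp add: sum_power2_eq_zero_iff)
      qed
      then show "\<And>y r. ?f y = of_real r \<Longrightarrow> u y = r" .
      \<comment> \<open>The second coordinate of \<open>?f x\<close> must vanish. Testing
        \<open>u\<close> against the norm at (1 + s e) x gives 1 + s^2 \<le> sqrt (1 + s^2), which
        forces s = 0.\<close>
      have "u (smul e x) = 0"
      proof -
        define s where "s = u (smul e x)"
        have "1 + s\<^sup>2 = u (smul (of_real 1 + of_real s * e) x)"
          using u_scale[of s "smul e x"] by (simp add: scale_left_distrib u_add u(3) s_def power2_eq_square)
        also have "\<dots> \<le> sqrt (1\<^sup>2 + s\<^sup>2)"
          using u(2) complex(3)[of 1 s] by (metis norm_scale x mult.right_neutral)
        finally have "1 + s\<^sup>2 \<le> sqrt (1 + s\<^sup>2)" by simp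
        then have "(1 + s\<^sup>2)\<^sup>2 \<le> 1 + s\<^sup>2"
          by (metis abs_of_nonneg add_nonneg_nonneg power_mono real_sqrt_pow2 zero_le_one zero_le_power2)
        then have "(1 + s\<^sup>2) * (1 + s\<^sup>2) \<le> (1 + s\<^sup>2) * 1"
          by (simp only: power2_eq_square[of "1 + s\<^sup>2"] mult_1_right)
        moreover have "0 < 1 + s\<^sup>2" by (simp add: add_pos_nonneg)
        ultimately have "1 + s\<^sup>2 \<le> 1" by (rule mult_left_le_imp_le)
        then have "s\<^sup>2 = 0" by simp
        then show ?thesis by (simp add: s_def)
      qed
      then show "?f x = 1" by (simp add: u(3))
    qed (use u x in auto)
    then show ?thesis by blast
  qed
qed

text \<open>The dimension hypothesis supplies a nonempty basis; its elements are nonzero by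
  independence, and one of them is normalized.\<close>

lemma exists_unit_vector:
  fixes smul :: "'k::real_or_complex \<Rightarrow> 'a::real_normed_vector \<Rightarrow> 'a"
  assumes "normed_space_over smul" and "dim_at_least smul 2"
  obtains x :: 'a where "norm x = 1"
proof -
  interpret normed_space_over smul by (rule assms)
  obtain B where B: "\<not> dependent B" "infinite B \<or> 2 \<le> card B"
    using assms(2) by (auto simp: dim_at_least_def)
  then have "B \<noteq> {}" by auto
  then obtain b where "b \<in> B" by blast
  then have "b \<noteq> 0" using B(1) dependent_zero by blast
  then show ?thesis using that[of "inverse (norm b) *\<^sub>R b"] by simp
qed

section \<open>Suprema of moduli and alignment of scalars\<close>

lemma SUP_approx:
  fixes g :: "'i \<Rightarrow> real"
  assumes "W \<noteq> {}" and "bdd_above (g ` W)"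
  obtains w :: "nat \<Rightarrow> 'i" where "\<And>n. w n \<in> W" "(\<lambda>n. g (w n)) \<longlonglongrightarrow> (SUP i\<in>W. g i)"
proof -
  have "(SUP i\<in>W. g i) \<in> closure (g ` W)"
    using assms by (intro closure_contains_Sup) auto
  then obtain y where y: "\<And>n. y n \<in> g ` W" "y \<longlonglongrightarrow> (SUP i\<in>W. g i)"
    unfolding closure_sequential by blast
  from y(1) have "\<exists>w. \<forall>n. w n \<in> W \<and> g (w n) = y n" by (intro choice) (metis imageE)
  then obtain w where "\<And>n. w n \<in> W" "\<And>n. g (w n) = y n" by blast
  with y(2) that[of w] show ?thesis by simp
qed

lemma exists_aligning_scalar:
  fixes a b :: "'k::real_normed_field"
  obtains c where "norm c = 1" "norm (a + c * b) = norm a + norm b"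
proof (cases "a = 0 \<or> b = 0")
  case True
  then show ?thesis using that[of 1] by auto
next
  case False
  \<comment> \<open>The phase of \<open>a\<close> times the inverse phase of \<open>b\<close>: then
    \<open>c * b\<close> is the positive multiple of \<open>a\<close> by
    \<open>norm b / norm a\<close>.\<close>
  define c where "c = a / of_real (norm a) * (of_real (norm b) / b)"
  have "a + c * b = a * of_real (1 + norm b / norm a)"
    using False by (simp add: c_def field_simps)
  then have "norm (a + c * b) = norm a * \<bar>1 + norm b / norm a\<bar>"
    by (simp only: norm_mult norm_of_real)
  also have "\<dots> = norm a + norm b"
    using False by (simp add: field_simps)
  finally have "norm (a + c * b) = norm a + norm b" .
  moreover have "norm c = 1"
    using False by (simp add: c_def norm_mult norm_divide)
  ultimately show ?thesis using that by blast
qed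

text \<open>The operators enter only through two families of scalars on a common index set. In the
  theorem \<open>W\<close> consists of the norming pairs, and \<open>a\<close>, \<open>b\<close> are
  the values obtained from \<open>T\<close> and \<open>S\<close>.\<close>

context
  fixes W :: "'i set" and a b :: "'i \<Rightarrow> 'k::real_or_complex" and va vb :: real
  assumes ne: "W \<noteq> {}"
    and bdd_a: "bdd_above ((\<lambda>w. norm (a w)) ` W)"
    and bdd_b: "bdd_above ((\<lambda>w. norm (b w)) ` W)"
  defines "va \<equiv> SUP w\<in>W. norm (a w)" and "vb \<equiv> SUP w\<in>W. norm (b w)"
begin

lemma norm_le_SUP: "w \<in> W \<Longrightarrow> norm (a w) \<le> va" "w \<in> W \<Longrightarrow> norm (b w) \<le> vb"
  unfolding va_def vb_def by (auto intro: cSUP_upper bdd_a bdd_b)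

lemma norm_add_le_SUP:
  assumes "norm c = 1" and "w \<in> W"
  shows "norm (a w + c * b w) \<le> va + vb"
  using norm_triangle_ineq[of "a w" "c * b w"] norm_le_SUP[OF assms(2)] assms(1)
  by (simp add: norm_mult)

text \<open>\<open>norm (a w)\<close> lies between \<open>norm (a w + c * b w) - vb\<close> and
  \<open>va\<close>, and symmetrically for \<open>b\<close>. Along a maximizing sequence for the sum
  these bounds meet.\<close>

lemma SUP_norm_add_imp_limits:
  assumes c: "norm c = 1" and sup: "(SUP w\<in>W. norm (a w + c * b w)) = va + vb"
  obtains w :: "nat \<Rightarrow> 'i" where "\<And>n. w n \<in> W"
    "(\<lambda>n. norm (a (w n))) \<longlonglongrightarrow> va" "(\<lambda>n. norm (b (w n))) \<longlonglongrightarrow> vb"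
proof -
  obtain w :: "nat \<Rightarrow> 'i" where w: "\<And>n. w n \<in> W"
      and lim: "(\<lambda>n. norm (a (w n) + c * b (w n))) \<longlonglongrightarrow> va + vb"
    using SUP_approx[OF ne, of "\<lambda>w. norm (a w + c * b w)"]
      bdd_aboveI2[of W "\<lambda>w. norm (a w + c * b w)", OF norm_add_le_SUP[OF c]]
    unfolding sup by blast
  have le: "norm (a (w n) + c * b (w n)) \<le> norm (a (w n)) + norm (b (w n))" for n
    using norm_triangle_ineq[of "a (w n)" "c * b (w n)"] c by (simp add: norm_mult)
  have "(\<lambda>n. norm (a (w n))) \<longlonglongrightarrow> va"
  proof (rule tendsto_sandwich[OF _ _ _ tendsto_const])
    show "(\<lambda>n. norm (a (w n) + c * b (w n)) - vb) \<longlonglongrightarrow> va"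
      using tendsto_diff[OF lim tendsto_const[of vb]] by simp
    show "\<forall>\<^sub>F n in sequentially. norm (a (w n) + c * b (w n)) - vb \<le> norm (a (w n))"
      using le norm_le_SUP(2)[OF w] by (intro always_eventually) (smt (verit))
    show "\<forall>\<^sub>F n in sequentially. norm (a (w n)) \<le> va"
      using norm_le_SUP(1)[OF w] by simp
  qed
  moreover have "(\<lambda>n. norm (b (w n))) \<longlonglongrightarrow> vb"
  proof (rule tendsto_sandwich[OF _ _ _ tendsto_const])
    show "(\<lambda>n. norm (a (w n) + c * b (w n)) - va) \<longlonglongrightarrow> vb"
      using tendsto_diff[OF lim tendsto_const[of va]] by simp
    show "\<forall>\<^sub>F n in sequentially. norm (a (w n) + c * b (w n)) - va \<le> norm (b (w n))"
      using le norm_le_SUP(1)[OF w] by (intro always_eventually) (smt (verit))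
    show "\<forall>\<^sub>F n in sequentially. norm (b (w n)) \<le> vb"
      using norm_le_SUP(2)[OF w] by simp
  qed
  ultimately show ?thesis using that w by blast
qed

text \<open>The aligning scalar depends on \<open>n\<close>; compactness replaces it, along a
  subsequence, by a single limit \<open>l\<close>.\<close>

lemma limits_imp_SUP_norm_add:
  fixes w :: "nat \<Rightarrow> 'i"
  assumes w: "\<And>n. w n \<in> W"
    and lim_a: "(\<lambda>n. norm (a (w n))) \<longlonglongrightarrow> va" and lim_b: "(\<lambda>n. norm (b (w n))) \<longlonglongrightarrow> vb"
  obtains c where "norm c = 1" "(SUP w\<in>W. norm (a w + c * b w)) = va + vb"
proof -
  have "\<exists>c. \<forall>n. norm (c n) = 1 \<and>
      norm (a (w n) + c n * b (w n)) = norm (a (w n)) + norm (b (w n))"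
    by (intro choice allI) (metis exists_aligning_scalar)
  then obtain c where c: "\<And>n. norm (c n) = 1"
      "\<And>n. norm (a (w n) + c n * b (w n)) = norm (a (w n)) + norm (b (w n))"
    by blast
  have "\<forall>n. c n \<in> sphere 0 1" using c(1) by simp
  then obtain l r where l: "l \<in> sphere 0 1" and r: "strict_mono r" and lim_c: "(c \<circ> r) \<longlonglongrightarrow> l"
    using compact_unit_sphere[where 'k = 'k, unfolded compact_def] by blast
  have l1: "norm l = 1" using l by simp
  let ?v = "SUP w\<in>W. norm (a w + l * b w)"
  have upper: "norm (a w + l * b w) \<le> ?v" if "w \<in> W" for w
    using norm_add_le_SUP[OF l1] that by (intro cSUP_upper bdd_aboveI2) auto
  have "va + vb \<le> ?v"
  proof (rule LIMSEQ_le_const2)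
    \<comment> \<open>Using \<open>l\<close> instead of \<open>c (r n)\<close> costs at most
      \<open>norm (l - c (r n))\<close> times a convergent sequence, so the error vanishes in the
      limit.\<close>
    have "(\<lambda>n. norm (l - c (r n))) \<longlonglongrightarrow> 0"
      using tendsto_norm[OF tendsto_diff[OF tendsto_const[of l] lim_c]] by simp
    moreover have "(\<lambda>n. norm (a (w (r n)))) \<longlonglongrightarrow> va" "(\<lambda>n. norm (b (w (r n)))) \<longlonglongrightarrow> vb"
      using LIMSEQ_subseq_LIMSEQ[OF lim_a r] LIMSEQ_subseq_LIMSEQ[OF lim_b r]
      by (simp_all add: o_def)
    ultimately have "(\<lambda>n. norm (a (w (r n))) + norm (b (w (r n)))
        - norm (l - c (r n)) * norm (b (w (r n)))) \<longlonglongrightarrow> va + vb - 0 * vb"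
      by (intro tendsto_intros)
    then show "(\<lambda>n. norm (a (w (r n))) + norm (b (w (r n)))
        - norm (l - c (r n)) * norm (b (w (r n)))) \<longlonglongrightarrow> va + vb" by simp
    have "norm (a (w n)) + norm (b (w n)) - norm (l - c n) * norm (b (w n)) \<le> ?v" for n
    proof -
      have "a (w n) + c n * b (w n) = (a (w n) + l * b (w n)) - (l - c n) * b (w n)"
        by (simp add: algebra_simps)
      then have "norm (a (w n)) + norm (b (w n))
          \<le> norm (a (w n) + l * b (w n)) + norm (l - c n) * norm (b (w n))"
        unfolding c(2)[symmetric] norm_mult[symmetric] by (metis norm_triangle_ineq4)
      with upper[OF w, of n] show ?thesis by simp
    qed
    then show "\<exists>N. \<forall>n\<ge>N. norm (a (w (r n))) + norm (b (w (r n)))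
        - norm (l - c (r n)) * norm (b (w (r n))) \<le> ?v" by blast
  qed
  moreover have "?v \<le> va + vb"
    using norm_add_le_SUP[OF l1] ne by (intro cSUP_least) auto
  ultimately show ?thesis using that[OF l1] by simp
qed

text \<open>If both suprema are positive, dividing by \<open>vb\<close> squeezes
  \<open>norm (a w)\<close> between \<open>norm (a w) * norm (b w) / vb\<close> and
  \<open>va\<close>; dividing by \<open>va\<close> treats \<open>b\<close> likewise.\<close>

lemma limit_product_imp_limits:
  fixes w :: "nat \<Rightarrow> 'i"
  assumes w: "\<And>n. w n \<in> W"
    and lim: "(\<lambda>n. norm (a (w n)) * norm (b (w n))) \<longlonglongrightarrow> va * vb"
  obtains z :: "nat \<Rightarrow> 'i" where "\<And>n. z n \<in> W"
    "(\<lambda>n. norm (a (z n))) \<longlonglongrightarrow> va" "(\<lambda>n. norm (b (z n))) \<longlonglongrightarrow> vb"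
proof -
  have nonneg: "0 \<le> va" "0 \<le> vb"
    using norm_le_SUP[OF w] by (meson norm_ge_zero order_trans)+
  consider "va = 0" | "vb = 0" | "0 < va" "0 < vb" using nonneg by linarith
  then show ?thesis
  proof cases
    \<comment> \<open>All moduli of \<open>a\<close> vanish, so \<open>w\<close> is dropped for a
      maximizing sequence of \<open>b\<close>.\<close>
    case 1
    obtain z :: "nat \<Rightarrow> 'i" where z: "\<And>n. z n \<in> W" "(\<lambda>n. norm (b (z n))) \<longlonglongrightarrow> vb"
      using SUP_approx[OF ne bdd_b] unfolding vb_def by blast
    have "norm (a (z n)) = va" for n
      using norm_le_SUP(1)[OF z(1)[of n]] 1 by simp
    then show ?thesis by (intro that[of z] z) simp
  next
    case 2
    obtain z :: "nat \<Rightarrow> 'i" where z: "\<And>n. z n \<in> W" "(\<lambda>n. norm (a (z n))) \<longlonglongrightarrow> va"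
      using SUP_approx[OF ne bdd_a] unfolding va_def by blast
    have "norm (b (z n)) = vb" for n
      using norm_le_SUP(2)[OF z(1)[of n]] 2 by simp
    then show ?thesis by (intro that[of z] z) simp
  next
    case 3
    have "(\<lambda>n. norm (a (w n))) \<longlonglongrightarrow> va"
    proof (rule tendsto_sandwich[OF _ _ _ tendsto_const])
      show "(\<lambda>n. norm (a (w n)) * norm (b (w n)) / vb) \<longlonglongrightarrow> va"
        using tendsto_divide[OF lim tendsto_const[of vb]] 3 by simp
      show "\<forall>\<^sub>F n in sequentially. norm (a (w n)) * norm (b (w n)) / vb \<le> norm (a (w n))"
        using norm_le_SUP(2)[OF w] 3 by (simp add: divide_le_eq mult_left_mono)
      show "\<forall>\<^sub>F n in sequentially. norm (a (w n)) \<le> va"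
        using norm_le_SUP(1)[OF w] by simp
    qed
    moreover have "(\<lambda>n. norm (b (w n))) \<longlonglongrightarrow> vb"
    proof (rule tendsto_sandwich[OF _ _ _ tendsto_const])
      show "(\<lambda>n. norm (a (w n)) * norm (b (w n)) / va) \<longlonglongrightarrow> vb"
        using tendsto_divide[OF lim tendsto_const[of va]] 3 by simp
      show "\<forall>\<^sub>F n in sequentially. norm (a (w n)) * norm (b (w n)) / va \<le> norm (b (w n))"
        using norm_le_SUP(1)[OF w] 3
        by (simp add: divide_le_eq mult_right_mono mult.commute[of _ va])
      show "\<forall>\<^sub>F n in sequentially. norm (b (w n)) \<le> vb"
        using norm_le_SUP(2)[OF w] by simp
    qed
    ultimately show ?thesis using that w by blast
  qed
qed

end

section \<open>The numerical radius over norming pairs, and the equivalences\<close>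

definition norming_pairs ::
    "('k::real_or_complex \<Rightarrow> 'a::real_normed_vector \<Rightarrow> 'a) \<Rightarrow> ('a \<times> ('a \<Rightarrow> 'k)) set" where
  "norming_pairs smul = {(x, f). x \<in> sphere 0 1 \<and> f \<in> dual_sphere smul \<and> f x = 1}"

text \<open>On the unit sphere \<open>of_real (norm x)\<close> is 1, so the two index sets
  agree.\<close>

lemma numerical_radius_eq_SUP:
  "numerical_radius smul T = (SUP w\<in>norming_pairs smul. norm (snd w (T (fst w))))"
  unfolding numerical_radius_def
  by (rule arg_cong[where f = Sup])
    (force simp: norming_pairs_def support_functionals_def image_iff)

lemma (in normed_space_over) norm_dual_sphere_le:
  assumes "f \<in> dual_sphere smul"
  shows "norm (f y) \<le> norm y"
proof -
  from assms obtain K where lin: "Vector_Spaces.linear smul (*) f"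
      and K: "\<And>y. norm (f y) \<le> K * norm y" and f1: "onorm f = 1"
    by (auto simp: dual_sphere_def dual_space_def bounded_linear_over_def)
  have "norm (f y) \<le> onorm f * norm y"
    using bounded_linear_functional[OF lin K] by (rule onorm)
  with f1 show ?thesis by simp
qed

text \<open>Functionals of norm one do not increase norms, so a bound for \<open>T\<close> bounds
  all values; this makes the real \<open>Sup\<close> an actual supremum.\<close>

lemma (in normed_space_over) bdd_above_numerical_range:
  assumes "T \<in> bounded_operators smul"
  shows "bdd_above ((\<lambda>w. norm (snd w (T (fst w)))) ` norming_pairs smul)"
proof -
  from assms obtain K where K: "\<And>x. norm (T x) \<le> K * norm x"
    by (auto simp: bounded_operators_def bounded_linear_over_def)
  have "norm (snd w (T (fst w))) \<le> K" if "w \<in> norming_pairs smul" for w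
  proof -
    have "norm (snd w (T (fst w))) \<le> norm (T (fst w))"
      using that by (intro norm_dual_sphere_le) (auto simp: norming_pairs_def)
    also have "\<dots> \<le> K" using K[of "fst w"] that by (auto simp: norming_pairs_def)
    finally show ?thesis .
  qed
  then show ?thesis by (rule bdd_aboveI2)
qed

theorem theorem9:
  fixes smul :: "'k::real_or_complex \<Rightarrow> 'a::real_normed_vector \<Rightarrow> 'a"
    and T S :: "'a \<Rightarrow> 'a"
  assumes "normed_space_over smul"
    and "dim_at_least smul 2"
    and "T \<in> bounded_operators smul"
    and "S \<in> bounded_operators smul"
  shows
    "(numerical_radius_parallel smul T S \<longleftrightarrow>
       (\<exists>(x :: nat \<Rightarrow> 'a) (f :: nat \<Rightarrow> 'a \<Rightarrow> 'k).
          (\<forall>n. x n \<in> sphere 0 1 \<and> f n \<in> dual_sphere smul \<and> f n (x n) = 1) \<and>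
          (\<lambda>n. norm (f n (T (x n))) * norm (f n (S (x n))))
            \<longlonglongrightarrow> numerical_radius smul T * numerical_radius smul S)) \<and>
     (numerical_radius_parallel smul T S \<longleftrightarrow>
       (\<exists>(x :: nat \<Rightarrow> 'a) (f :: nat \<Rightarrow> 'a \<Rightarrow> 'k).
          (\<forall>n. x n \<in> sphere 0 1 \<and> f n \<in> dual_sphere smul \<and> f n (x n) = 1) \<and>
          (\<lambda>n. norm (f n (T (x n)))) \<longlonglongrightarrow> numerical_radius smul T \<and>
          (\<lambda>n. norm (f n (S (x n)))) \<longlonglongrightarrow> numerical_radius smul S))"
proof -
  interpret normed_space_over smul by (rule assms)
  let ?W = "norming_pairs smul"
  let ?a = "\<lambda>w :: 'a \<times> ('a \<Rightarrow> 'k). snd w (T (fst w))"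
  let ?b = "\<lambda>w :: 'a \<times> ('a \<Rightarrow> 'k). snd w (S (fst w))"
  let ?va = "numerical_radius smul T" and ?vb = "numerical_radius smul S"
  \<comment> \<open>A unit vector comes from the dimension hypothesis, a functional norming it from
    Hahn--Banach.\<close>
  have ne: "?W \<noteq> {}"
  proof -
    obtain x :: 'a where x: "norm x = 1" using exists_unit_vector[OF assms(1,2)] .
    then show ?thesis using support_functionals_nonempty[OF x]
      by (auto simp: norming_pairs_def support_functionals_def)
  qed
  note bdd = bdd_above_numerical_range[OF assms(3)] bdd_above_numerical_range[OF assms(4)]
  note va = numerical_radius_eq_SUP[of smul T] and vb = numerical_radius_eq_SUP[of smul S]
  \<comment> \<open>Linearity of each functional turns parallelism into a statement about the
    supremum of the moduli of \<open>?a w + c * ?b w\<close>.\<close>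
  have "numerical_radius smul (\<lambda>x. T x + smul c (S x)) = (SUP w\<in>?W. norm (?a w + c * ?b w))" for c
  proof -
    have "f (y + smul c z) = f y + c * f z" if f: "f \<in> dual_sphere smul" for f y z
    proof -
      interpret f: Vector_Spaces.linear smul "(*)" f
        using f by (auto simp: dual_sphere_def dual_space_def bounded_linear_over_def)
      show ?thesis by (simp add: f.add f.scale)
    qed
    then show ?thesis
      unfolding numerical_radius_eq_SUP by (intro SUP_cong) (auto simp: norming_pairs_def)
  qed
  then have par: "numerical_radius_parallel smul T S \<longleftrightarrow>
      (\<exists>c. norm c = 1 \<and> (SUP w\<in>?W. norm (?a w + c * ?b w)) = ?va + ?vb)"
    by (simp add: numerical_radius_parallel_def)
  let ?lim = "\<lambda>w. (\<forall>n. w n \<in> ?W) \<and> (\<lambda>n. norm (?a (w n))) \<longlonglongrightarrow> ?va \<and> (\<lambda>n. norm (?b (w n))) \<longlonglongrightarrow> ?vb"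
  let ?lim_prod = "\<lambda>w. (\<forall>n. w n \<in> ?W) \<and> (\<lambda>n. norm (?a (w n)) * norm (?b (w n))) \<longlonglongrightarrow> ?va * ?vb"
  \<comment> \<open>Conditions (i) and (iii), the latter phrased with one sequence of pairs.\<close>
  have par_lim: "numerical_radius_parallel smul T S \<longleftrightarrow> (\<exists>w. ?lim w)"
  proof
    assume "numerical_radius_parallel smul T S"
    then obtain c where "norm c = 1" "(SUP w\<in>?W. norm (?a w + c * ?b w)) = ?va + ?vb"
      unfolding par by blast
    then obtain w where "\<And>n. w n \<in> ?W" "(\<lambda>n. norm (?a (w n))) \<longlonglongrightarrow> ?va"
        "(\<lambda>n. norm (?b (w n))) \<longlonglongrightarrow> ?vb"
      by (rule SUP_norm_add_imp_limits[OF ne bdd, folded va vb]) (rule that)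
    then show "\<exists>w. ?lim w" by (intro exI[of _ w]) simp
  next
    assume "\<exists>w. ?lim w"
    then obtain w where "\<And>n. w n \<in> ?W" "(\<lambda>n. norm (?a (w n))) \<longlonglongrightarrow> ?va"
        "(\<lambda>n. norm (?b (w n))) \<longlonglongrightarrow> ?vb" by blast
    then obtain c where "norm c = 1" "(SUP w\<in>?W. norm (?a w + c * ?b w)) = ?va + ?vb"
      by (rule limits_imp_SUP_norm_add[OF ne bdd, folded va vb])
    then show "numerical_radius_parallel smul T S"
      unfolding par by (intro exI[of _ c]) simp
  qed
  \<comment> \<open>Conditions (iii) and (ii). The sequence may change on the way back, when a
    radius is zero.\<close>
  have lim_prod: "(\<exists>w. ?lim w) \<longleftrightarrow> (\<exists>w. ?lim_prod w)"
  proof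
    assume "\<exists>w. ?lim w"
    then obtain w where w: "\<And>n. w n \<in> ?W" and "(\<lambda>n. norm (?a (w n))) \<longlonglongrightarrow> ?va"
        "(\<lambda>n. norm (?b (w n))) \<longlonglongrightarrow> ?vb" by blast
    then have "(\<lambda>n. norm (?a (w n)) * norm (?b (w n))) \<longlonglongrightarrow> ?va * ?vb"
      by (intro tendsto_mult)
    with w show "\<exists>w. ?lim_prod w" by (intro exI[of _ w]) simp
  next
    assume "\<exists>w. ?lim_prod w"
    then obtain w where "\<And>n. w n \<in> ?W"
        "(\<lambda>n. norm (?a (w n)) * norm (?b (w n))) \<longlonglongrightarrow> ?va * ?vb" by blast
    then obtain z where "\<And>n. z n \<in> ?W" "(\<lambda>n. norm (?a (z n))) \<longlonglongrightarrow> ?va"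
        "(\<lambda>n. norm (?b (z n))) \<longlonglongrightarrow> ?vb"
      by (rule limit_product_imp_limits[OF ne bdd, folded va vb]) (rule that)
    then show "\<exists>w. ?lim w" by (intro exI[of _ z]) simp
  qed
  \<comment> \<open>Two sequences are traded for one sequence of pairs; \<open>P\<close> is left
    general so that this serves both (ii) and (iii).\<close>
  have pairs: "(\<exists>x f. P x f) \<longleftrightarrow> (\<exists>w. P (\<lambda>n. fst (w n)) (\<lambda>n. snd (w n)))"
    for P :: "(nat \<Rightarrow> 'a) \<Rightarrow> (nat \<Rightarrow> 'a \<Rightarrow> 'k) \<Rightarrow> bool"
  proof
    assume "\<exists>x f. P x f"
    then obtain x f where "P x f" by blast
    then show "\<exists>w. P (\<lambda>n. fst (w n)) (\<lambda>n. snd (w n))"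
      by (intro exI[of _ "\<lambda>n. (x n, f n)"]) simp
  qed blast
  have mem: "w \<in> ?W \<longleftrightarrow> fst w \<in> sphere 0 1 \<and> snd w \<in> dual_sphere smul \<and> snd w (fst w) = 1" for w
    by (auto simp: norming_pairs_def)
  show ?thesis
    unfolding pairs mem[symmetric] par_lim lim_prod[symmetric] by (intro conjI refl)
qed

end
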